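(* The number of pieces $R$ in the total dual class function $U_{\langle v_1,\dots,v_N\rangle}(\cdot)$ is at most $O(N^2K\min\{N,K\})$.
   Context: A seller has $K$ identical units of an item. Sample $i\in[N]$ is given by a valuation $v_i:\{1,\dots,K\}\to\mathbb{R}_{\ge0}$ (with value $0$ for buying nothing). A two-part tariff is $\rho=(p_1,p_2)$ with $p_1,p_2\ge0$: buying $q\ge1$ units costs $p_1+p_2q$. In sample $i$ the buyer purchases a quantity $q\in\{1,\dots,K\}$ maximizing $v_i(q)-(p_1+p_2q)$, and zero units if this is negative for every $q>0$. The revenue from sample $i$ is $0$ if nothing is bought and $p_1+p_2q$ if $q>0$ units are bought; $U_{\langle v_1,\dots,v_N\rangle}(\rho)$ is the total revenue over the $N$ samples. Its pieces are the distinct regions of the $(p_1,p_2)$ space on which the buyer's purchased quantity in every sample is fixed. *)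

theory Defs
  imports Complex_Main
begin

type_synonym tariff = "real \<times> real"

definition tariffs :: "tariff set" where
  "tariffs = {\<rho>. 0 \<le> fst \<rho> \<and> 0 \<le> snd \<rho>}"

definition cost :: "tariff \<Rightarrow> nat \<Rightarrow> real" where
  "cost \<rho> q = fst \<rho> + snd \<rho> * real q"

definition utility :: "(nat \<Rightarrow> real) \<Rightarrow> tariff \<Rightarrow> nat \<Rightarrow> real" where
  "utility w \<rho> q = w q - cost \<rho> q"

definition best_quantities :: "nat \<Rightarrow> (nat \<Rightarrow> real) \<Rightarrow> tariff \<Rightarrow> nat set" where
  "best_quantities K w \<rho> = {q. is_arg_max (utility w \<rho>) (\<lambda>q. q \<in> {1..K}) q}"

text \<open>
  The buyer may be indifferent between several positive quantities. A tie-breaking rule picks one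
  of the maximizers as a function of the set of maximizers; smallest and largest quantity are
  the instances \<open>Min\<close> and \<open>Max\<close>. A choice allowed to vary with the tariff while the set of
  maximizers stays the same would not give a well-behaved partition of the tariff space.
\<close>

definition tie_breaking :: "nat \<Rightarrow> (nat set \<Rightarrow> nat) \<Rightarrow> bool" where
  "tie_breaking K t \<longleftrightarrow> (\<forall>A. A \<noteq> {} \<and> A \<subseteq> {1..K} \<longrightarrow> t A \<in> A)"

definition purchase :: "nat \<Rightarrow> (nat set \<Rightarrow> nat) \<Rightarrow> (nat \<Rightarrow> real) \<Rightarrow> tariff \<Rightarrow> nat" where
  "purchase K t w \<rho> =
     (if \<forall>q\<in>{1..K}. utility w \<rho> q < 0 then 0 else t (best_quantities K w \<rho>))"

definition revenue :: "nat \<Rightarrow> (nat set \<Rightarrow> nat) \<Rightarrow> (nat \<Rightarrow> real) \<Rightarrow> tariff \<Rightarrow> real" where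
  "revenue K t w \<rho> =
     (if purchase K t w \<rho> = 0 then 0 else cost \<rho> (purchase K t w \<rho>))"

definition total_revenue ::
  "nat \<Rightarrow> nat \<Rightarrow> (nat \<Rightarrow> nat set \<Rightarrow> nat) \<Rightarrow> (nat \<Rightarrow> nat \<Rightarrow> real) \<Rightarrow> tariff \<Rightarrow> real" where
  "total_revenue N K t v \<rho> = (\<Sum>i = 1..N. revenue K (t i) (v i) \<rho>)"

definition pieces ::
  "nat \<Rightarrow> nat \<Rightarrow> (nat \<Rightarrow> nat set \<Rightarrow> nat) \<Rightarrow> (nat \<Rightarrow> nat \<Rightarrow> real) \<Rightarrow> tariff set set" where
  "pieces N K t v =
     {S. S \<noteq> {} \<and>
         (\<exists>Q. S = {\<rho> \<in> tariffs. \<forall>i\<in>{1..N}. purchase K (t i) (v i) \<rho> = Q i})}"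

lemma total_revenue_linear_on_piece:
  assumes "S \<in> pieces N K t v"
  shows "\<exists>a b. \<forall>\<rho>\<in>S. total_revenue N K t v \<rho> = a * fst \<rho> + b * snd \<rho>"
proof -
  from assms obtain Q
    where S: "S = {\<rho> \<in> tariffs. \<forall>i\<in>{1..N}. purchase K (t i) (v i) \<rho> = Q i}"
    by (auto simp: pieces_def)
  have "total_revenue N K t v \<rho> =
      (\<Sum>i = 1..N. if Q i = 0 then 0 else 1) * fst \<rho> + (\<Sum>i = 1..N. real (Q i)) * snd \<rho>"
    if "\<rho> \<in> S" for \<rho>
    unfolding total_revenue_def sum_distrib_right sum.distrib [symmetric]
    using that by (intro sum.cong) (auto simp: S revenue_def cost_def)
  then show ?thesis by blast
qed

end

theory Submission
  imports Defs
begin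

text \<open>
  For a per-unit price \<open>y\<close>, sample \<open>i\<close> buys iff \<open>p\<^sub>1 \<le> f\<^sub>i y\<close>, where \<open>f\<^sub>i\<close> is the upper
  envelope of the \<open>K\<close> lines \<open>v\<^sub>i q - y q\<close>. Raising \<open>p\<^sub>1\<close> to the next value \<open>f\<^sub>i y\<close> does not
  change any purchase, so every purchase vector is zero or occurs on one of the \<open>N\<close> curves
  \<open>p\<^sub>1 = f\<^sub>i y\<close>. Along such a curve the vector changes only where the demand of some sample \<open>j\<close>
  changes or where \<open>f\<^sub>j - f\<^sub>i\<close> changes sign, which is \<open>O(K)\<close> times for each \<open>j\<close>. Altogether there
  are \<open>O(N\<^sup>2 K)\<close> vectors, even without the factor \<open>min N K\<close>.
\<close>

section \<open>Piecewise constant functions on the real line\<close>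

text \<open>A monotone rank through which \<open>h\<close> factors replaces a list of breakpoints:
  ranks of several functions can be added, and an isolated value of \<open>h\<close> at a breakpoint
  simply gets its own rank.\<close>

definition at_most_jumps :: "nat \<Rightarrow> (real \<Rightarrow> 'a) \<Rightarrow> bool" where
  "at_most_jumps m h \<longleftrightarrow>
     (\<exists>r::real \<Rightarrow> nat. mono r \<and> (\<forall>y. r y \<le> m) \<and> (\<forall>y y'. r y = r y' \<longrightarrow> h y = h y'))"

lemma at_most_jumpsI:
  fixes r :: "real \<Rightarrow> nat"
  assumes mono: "\<And>y y'. y < y' \<Longrightarrow> r y \<le> r y'"
    and bound: "\<And>y. r y \<le> m"
    and eq: "\<And>y y'. y < y' \<Longrightarrow> r y = r y' \<Longrightarrow> h y = h y'"
  shows "at_most_jumps m h"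
  unfolding at_most_jumps_def
proof (intro exI conjI allI impI)
  show "mono r"
    using mono by (auto simp: mono_def order_le_less)
  show "h y = h y'" if "r y = r y'" for y y'
    using that eq by (metis linorder_neqE)
qed (rule bound)

lemma at_most_jumps_comp: "at_most_jumps m h \<Longrightarrow> at_most_jumps m (\<lambda>y. g (h y))"
  unfolding at_most_jumps_def by metis

lemma card_range_at_most_jumps:
  assumes "at_most_jumps m h"
  shows "finite (range h)" and "card (range h) \<le> Suc m"
proof -
  obtain r :: "real \<Rightarrow> nat" where r: "\<And>y. r y \<le> m" "\<And>y y'. r y = r y' \<Longrightarrow> h y = h y'"
    using assms by (auto simp: at_most_jumps_def)
  have "h y = h (SOME y'. r y' = r y)" for y
    by (rule r(2), rule sym, rule someI[where P = "\<lambda>y'. r y' = r y"]) simp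
  then have sub: "range h \<subseteq> (\<lambda>k. h (SOME y. r y = k)) ` {..m}"
    using r(1) by blast
  then show "finite (range h)"
    by (rule finite_subset) simp
  show "card (range h) \<le> Suc m"
    using surj_card_le[OF _ sub] by simp
qed

text \<open>The sum of the rank functions is a rank function: it is constant between two points only if
  every summand is.\<close>

lemma at_most_jumps_family:
  assumes "finite I" and "\<And>i. i \<in> I \<Longrightarrow> at_most_jumps m (h i)"
  shows "at_most_jumps (card I * m) (\<lambda>y i. if i \<in> I then h i y else d)"
proof -
  have "\<forall>i\<in>I. \<exists>r::real \<Rightarrow> nat. mono r \<and> (\<forall>y. r y \<le> m) \<and> (\<forall>y y'. r y = r y' \<longrightarrow> h i y = h i y')"
    using assms(2) by (simp add: at_most_jumps_def)
  from bchoice[OF this] obtain r :: "'a \<Rightarrow> real \<Rightarrow> nat"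
    where r: "\<And>i. i \<in> I \<Longrightarrow> mono (r i)" "\<And>i y. i \<in> I \<Longrightarrow> r i y \<le> m"
      "\<And>i y y'. i \<in> I \<Longrightarrow> r i y = r i y' \<Longrightarrow> h i y = h i y'"
    by blast
  show ?thesis
  proof (rule at_most_jumpsI[where r = "\<lambda>y. \<Sum>i\<in>I. r i y"])
    fix y y' :: real
    assume "y < y'"
    then have le: "r i y \<le> r i y'" if "i \<in> I" for i
      using r(1)[OF that] by (simp add: monoD)
    then show "(\<Sum>i\<in>I. r i y) \<le> (\<Sum>i\<in>I. r i y')"
      by (rule sum_mono)
    assume "(\<Sum>i\<in>I. r i y) = (\<Sum>i\<in>I. r i y')"
    then have "r i y = r i y'" if "i \<in> I" for i
      using sum_mono_inv[of "\<lambda>i. r i y" I "\<lambda>i. r i y'"] le that assms(1) by blast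
    then show "(\<lambda>i. if i \<in> I then h i y else d) = (\<lambda>i. if i \<in> I then h i y' else d)"
      using r(3)[of _ y y'] by (intro ext) simp
  next
    show "(\<Sum>i\<in>I. r i y) \<le> card I * m" for y
      using sum_bounded_above[of I "\<lambda>i. r i y" m] r(2) by simp
  qed
qed

section \<open>Surplus and demand at a given per-unit price\<close>

definition surplus :: "nat \<Rightarrow> (nat \<Rightarrow> real) \<Rightarrow> real \<Rightarrow> real" where
  "surplus K w y = Max ((\<lambda>q. w q - y * real q) ` {1..K})"

definition demand :: "nat \<Rightarrow> (nat \<Rightarrow> real) \<Rightarrow> real \<Rightarrow> nat set" where
  "demand K w y = {q \<in> {1..K}. w q - y * real q = surplus K w y}"

lemma surplus_ge: "q \<in> {1..K} \<Longrightarrow> w q - y * real q \<le> surplus K w y"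
  by (simp add: surplus_def)

lemma surplus_eq: "q \<in> demand K w y \<Longrightarrow> surplus K w y = w q - y * real q"
  by (simp add: demand_def)

lemma demand_subset: "demand K w y \<subseteq> {1..K}"
  by (auto simp: demand_def)

lemma finite_demand: "finite (demand K w y)"
  by (rule finite_subset[OF demand_subset]) simp

lemma demand_nonempty:
  assumes "K \<ge> 1"
  shows "demand K w y \<noteq> {}"
proof -
  have "surplus K w y \<in> (\<lambda>q. w q - y * real q) ` {1..K}"
    unfolding surplus_def using assms by (intro Max_in) auto
  then show ?thesis
    by (auto simp: demand_def)
qed

text \<open>Revealed preference: adding the two optimality inequalities cancels
  \<open>w\<close>.\<close>

lemma demand_antimono:
  assumes "y < y'" "q \<in> demand K w y" "q' \<in> demand K w y'"
  shows "q' \<le> q"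
proof -
  have "w q' - y * real q' \<le> w q - y * real q" "w q - y' * real q \<le> w q' - y' * real q'"
    using assms surplus_ge[of q' K w y] surplus_ge[of q K w y'] by (auto simp: demand_def)
  then have "(y' - y) * real q' \<le> (y' - y) * real q"
    by (simp add: algebra_simps)
  then show ?thesis
    using assms(1) by simp
qed

text \<open>The fixed fee shifts the utility of every positive quantity equally, so it does not
  affect the maximizers.\<close>

lemma best_quantities_eq_demand:
  assumes "K \<ge> 1"
  shows "best_quantities K w \<rho> = demand K w (snd \<rho>)"
proof -
  obtain q0 where "q0 \<in> demand K w (snd \<rho>)"
    using demand_nonempty[OF assms] by blast
  then have q0: "q0 \<in> {1..K}" "w q0 - snd \<rho> * real q0 = surplus K w (snd \<rho>)"
    by (auto simp: demand_def)
  show ?thesis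
  proof (intro set_eqI iffI)
    fix q assume "q \<in> best_quantities K w \<rho>"
    then have q: "q \<in> {1..K}" "\<not> utility w \<rho> q < utility w \<rho> q0"
      using q0(1) by (auto simp: best_quantities_def is_arg_max_def)
    then show "q \<in> demand K w (snd \<rho>)"
      using q0 surplus_ge[OF q(1), of w "snd \<rho>"] by (simp add: demand_def utility_def cost_def)
  next
    fix q assume q: "q \<in> demand K w (snd \<rho>)"
    have "\<not> utility w \<rho> q < utility w \<rho> q'" if "q' \<in> {1..K}" for q'
      using q surplus_ge[OF that, of w "snd \<rho>"] by (simp add: demand_def utility_def cost_def)
    then show "q \<in> best_quantities K w \<rho>"
      using q by (auto simp: best_quantities_def is_arg_max_def demand_def)
  qed
qed

lemma purchase_eq:
  assumes "K \<ge> 1"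
  shows "purchase K t w (x, y) = (if surplus K w y < x then 0 else t (demand K w y))"
proof -
  have "(\<forall>q\<in>{1..K}. utility w (x, y) q < 0) \<longleftrightarrow> surplus K w y < x"
    unfolding surplus_def using assms
    by (subst Max_less_iff) (auto simp: utility_def cost_def algebra_simps)
  then show ?thesis
    by (simp add: purchase_def best_quantities_eq_demand[OF assms])
qed

section \<open>Changes of demand and of the decision to buy\<close>

text \<open>Using both ends of the demand set makes the rank rise once on entering a tie and again
  on leaving it, so a tie at a single price is told apart from both sides.\<close>

definition demand_rank :: "nat \<Rightarrow> (nat \<Rightarrow> real) \<Rightarrow> real \<Rightarrow> nat" where
  "demand_rank K w y = (K - Min (demand K w y)) + (K - Max (demand K w y))"

lemma demand_rank_le: "demand_rank K w y \<le> 2 * K"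
  by (simp add: demand_rank_def)

context
  fixes K :: nat and y y' :: real
  assumes K: "K \<ge> 1" and less: "y < y'"
begin

lemma demand_Min_Max:
  shows "Max (demand K w y') \<le> Min (demand K w y)"
    and "Min (demand K w z) \<le> Max (demand K w z)"
    and "Max (demand K w z) \<le> K"
proof -
  note ne = demand_nonempty[OF K] and fin = finite_demand
  show "Max (demand K w y') \<le> Min (demand K w y)"
    using demand_antimono[OF less Min_in[OF fin ne] Max_in[OF fin ne]] .
  show "Min (demand K w z) \<le> Max (demand K w z)"
    by (rule Max_ge[OF fin Min_in[OF fin ne]])
  show "Max (demand K w z) \<le> K"
    using Max_in[OF fin ne] demand_subset by fastforce
qed

lemma demand_rank_mono: "demand_rank K w y \<le> demand_rank K w y'"
  using demand_Min_Max(1)[of w] demand_Min_Max(2)[of w y] demand_Min_Max(2)[of w y']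
  unfolding demand_rank_def by linarith

text \<open>The demand sets at \<open>y < y'\<close> overlap in at most one quantity, so equal ranks force both to be
  the same singleton.\<close>

lemma demand_rank_eqE:
  assumes "demand_rank K w y = demand_rank K w y'"
  obtains q where "demand K w y = {q}" "demand K w y' = {q}"
proof -
  have eq: "Min (demand K w y) = Max (demand K w y)" "Min (demand K w y') = Max (demand K w y')"
    "Max (demand K w y) = Max (demand K w y')"
    using assms demand_Min_Max(1)[of w] demand_Min_Max(2,3)[of w y] demand_Min_Max(2,3)[of w y']
    unfolding demand_rank_def by linarith+
  have "demand K w z = {Max (demand K w z)}" if "Min (demand K w z) = Max (demand K w z)" for z
  proof -
    have "q = Max (demand K w z)" if "q \<in> demand K w z" for q
      using Min_le[OF finite_demand that] Max_ge[OF finite_demand that]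
        \<open>Min (demand K w z) = Max (demand K w z)\<close> by simp
    then show ?thesis
      using demand_nonempty[OF K] by blast
  qed
  then show thesis
    using eq that by metis
qed

end

text \<open>While both demands stay constant, the difference of the surpluses is affine, so the comparison
  switches at most once, in a direction given by the two demanded quantities. The last
  bit of the rank records the outcome, oriented so that it can only increase.\<close>

lemma demand_surplus_jumps:
  assumes K: "K \<ge> 1"
  shows "at_most_jumps (9 * K) (\<lambda>y. (demand K w y, surplus K w y < surplus K u y))"
proof -
  define s where "s y = demand_rank K u y + demand_rank K w y" for y
  \<comment> \<open>For demands \<open>{p}\<close> of \<open>u\<close> and \<open>{q}\<close> of
    \<open>w\<close>, \<open>surplus K u - surplus K w\<close> has slope \<open>q - p\<close> in
    \<open>y\<close>; \<open>Max\<close> merely reads off \<open>p\<close> and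
    \<open>q\<close>.\<close>
  define b where "b y \<longleftrightarrow>
    (Max (demand K u y) < Max (demand K w y)) = (surplus K w y < surplus K u y)" for y
  define r where "r y = 2 * s y + of_bool (b y)" for y
  have s_mono: "s y \<le> s y'" if "y < y'" for y y'
    unfolding s_def by (intro add_mono demand_rank_mono[OF K that])
  have same_s: "demand K w y = demand K w y' \<and> demand K u y = demand K u y' \<and> (b y \<longrightarrow> b y')"
    if less: "y < y'" and eq: "s y = s y'" for y y'
  proof -
    have "demand_rank K u y = demand_rank K u y'" "demand_rank K w y = demand_rank K w y'"
      using eq demand_rank_mono[OF K less, of u] demand_rank_mono[OF K less, of w]
      by (auto simp: s_def)
    then obtain p q where d: "demand K u y = {p}" "demand K u y' = {p}"
        "demand K w y = {q}" "demand K w y' = {q}"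
      using demand_rank_eqE[OF K less] by metis
    have S: "surplus K u y = u p - y * real p" "surplus K u y' = u p - y' * real p"
        "surplus K w y = w q - y * real q" "surplus K w y' = w q - y' * real q"
      by (rule surplus_eq; simp add: d)+
    have diff: "surplus K u y' - surplus K w y' =
        surplus K u y - surplus K w y + (y' - y) * (real q - real p)"
      by (simp add: S algebra_simps)
    have "b y'" if "b y"
    proof (cases "p < q")
      case True
      then have "(y' - y) * (real q - real p) \<ge> 0"
        using less by simp
      then show ?thesis
        using that True diff by (simp add: b_def d)
    next
      case False
      then have "(y' - y) * (real q - real p) \<le> 0"
        using less by (simp add: mult_nonneg_nonpos)
      then show ?thesis
        using that False diff by (simp add: b_def d)
    qed
    then show ?thesis
      by (simp add: d)
  qed
  show ?thesis
  proof (rule at_most_jumpsI[where r = r])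
    fix y y' :: real
    assume less: "y < y'"
    show "r y \<le> r y'"
      using s_mono[OF less] same_s[OF less] by (cases "s y = s y'") (auto simp: r_def of_bool_def)
    assume "r y = r y'"
    \<comment> \<open>The parity of the rank recovers \<open>b\<close>, its half recovers
      \<open>s\<close>.\<close>
    then have "s y = s y'" "b y = b y'"
      unfolding r_def by (auto simp: of_bool_def split: if_splits) presburger+
    then show "(demand K w y, surplus K w y < surplus K u y) =
        (demand K w y', surplus K w y' < surplus K u y')"
      using same_s[OF less] by (auto simp: b_def)
  next
    \<comment> \<open>Here \<open>s y\<close> is at most \<open>4 * K\<close>, and
      \<open>8 * K + 1\<close> is at most \<open>9 * K\<close> since \<open>K\<close> is
      positive.\<close>
    show "r y \<le> 9 * K" for y
      using K demand_rank_le[of K u y] demand_rank_le[of K w y]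
      by (auto simp: r_def s_def of_bool_def)
  qed
qed

section \<open>Purchase vectors on the curves and the count of pieces\<close>

text \<open>The default 0 off \<open>{1..N}\<close> lets vectors be counted as functions. Curve
  points outside \<open>tariffs\<close> are allowed; they can only enlarge the count.\<close>

definition curve_purchases ::
  "nat \<Rightarrow> nat \<Rightarrow> (nat \<Rightarrow> nat set \<Rightarrow> nat) \<Rightarrow> (nat \<Rightarrow> nat \<Rightarrow> real) \<Rightarrow> nat \<Rightarrow> real \<Rightarrow> nat \<Rightarrow> nat"
  where
  "curve_purchases N K t v i y =
     (\<lambda>j. if j \<in> {1..N} then purchase K (t j) (v j) (surplus K (v i) y, y) else 0)"

lemma card_range_curve_purchases:
  assumes K: "K \<ge> 1"
  shows "finite (range (curve_purchases N K t v i))"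
    and "card (range (curve_purchases N K t v i)) \<le> Suc (N * (9 * K))"
proof -
  have "at_most_jumps (9 * K) (\<lambda>y. purchase K (t j) (v j) (surplus K (v i) y, y))" for j
    using at_most_jumps_comp[OF demand_surplus_jumps[OF K, of "v j" "v i"],
        of "\<lambda>(A, lt). if lt then 0 else t j A"]
    by (simp add: purchase_eq[OF K])
  from at_most_jumps_family[of "{1..N}", OF _ this]
  have "at_most_jumps (N * (9 * K)) (curve_purchases N K t v i)"
    unfolding curve_purchases_def by simp
  then show "finite (range (curve_purchases N K t v i))"
    and "card (range (curve_purchases N K t v i)) \<le> Suc (N * (9 * K))"
    by (fact card_range_at_most_jumps)+
qed

lemma purchase_zero_or_on_curve:
  assumes K: "K \<ge> 1"
  shows "(\<forall>j\<in>{1..N}. purchase K (t j) (v j) (x, y) = 0) \<or>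
    (\<exists>i\<in>{1..N}. \<forall>j\<in>{1..N}. purchase K (t j) (v j) (x, y) = curve_purchases N K t v i y j)"
proof (cases "\<exists>i\<in>{1..N}. x \<le> surplus K (v i) y")
  case True
  define B where "B = {i \<in> {1..N}. x \<le> surplus K (v i) y}"
  have B: "finite B" "B \<noteq> {}"
    using True by (auto simp: B_def)
  define i where "i = arg_min_on (\<lambda>i. surplus K (v i) y) B"
  have i: "i \<in> B" and min: "\<And>j. j \<in> B \<Longrightarrow> surplus K (v i) y \<le> surplus K (v j) y"
    using arg_min_if_finite(1)[OF B] arg_min_least[OF B] by (auto simp: i_def)
  \<comment> \<open>Samples in \<open>B\<close> have at least the surplus of \<open>i\<close>; all
    others stay below \<open>x\<close>, which is at most that surplus.\<close>
  have "surplus K (v j) y < x \<longleftrightarrow> surplus K (v j) y < surplus K (v i) y" if "j \<in> {1..N}" for j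
    using i min[of j] that unfolding B_def mem_Collect_eq by linarith
  then have "\<forall>j\<in>{1..N}. purchase K (t j) (v j) (x, y) = curve_purchases N K t v i y j"
    by (simp add: curve_purchases_def purchase_eq[OF K])
  then show ?thesis
    using i by (auto simp: B_def)
qed (auto simp: purchase_eq[OF K] not_le)

lemma card_pieces_le:
  assumes K: "K \<ge> 1"
  shows "finite (pieces N K t v)" and "card (pieces N K t v) \<le> 1 + N * Suc (N * (9 * K))"
proof -
  define F where "F Q = {\<rho> \<in> tariffs. \<forall>i\<in>{1..N}. purchase K (t i) (v i) \<rho> = Q i}" for Q
  define U where "U = (\<Union>i\<in>{1..N}. range (curve_purchases N K t v i))"
  have sub: "pieces N K t v \<subseteq> F ` insert (\<lambda>_. 0) U"
  proof
    fix S assume "S \<in> pieces N K t v"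
    then obtain Q x y where S: "S = F Q" and xy: "(x, y) \<in> F Q"
      by (auto simp: pieces_def F_def)
    \<comment> \<open>Any point of a region determines its vector on \<open>{1..N}\<close>, so
      agreement at \<open>(x, y)\<close> suffices.\<close>
    have F_eq: "F Q = F Q'" if "\<forall>j\<in>{1..N}. purchase K (t j) (v j) (x, y) = Q' j" for Q'
      using that xy by (auto simp: F_def)
    from purchase_zero_or_on_curve[OF K, of N t v x y]
    show "S \<in> F ` insert (\<lambda>_. 0) U"
    proof
      assume "\<forall>j\<in>{1..N}. purchase K (t j) (v j) (x, y) = 0"
      then show ?thesis
        using F_eq[of "\<lambda>_. 0"] S by simp
    next
      assume "\<exists>i\<in>{1..N}. \<forall>j\<in>{1..N}.
        purchase K (t j) (v j) (x, y) = curve_purchases N K t v i y j"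
      then obtain i where i: "i \<in> {1..N}" and Fi: "F Q = F (curve_purchases N K t v i y)"
        using F_eq by blast
      have "curve_purchases N K t v i y \<in> U"
        unfolding U_def by (rule UN_I[OF i rangeI])
      then show ?thesis
        unfolding S Fi by (intro imageI insertI2)
    qed
  qed
  have fin: "finite U"
    using card_range_curve_purchases(1)[OF K] by (simp add: U_def)
  then show "finite (pieces N K t v)"
    using finite_subset[OF sub] by simp
  have "card U \<le> (\<Sum>i\<in>{1..N}. card (range (curve_purchases N K t v i)))"
    unfolding U_def by (rule card_UN_le) simp
  also have "\<dots> \<le> N * Suc (N * (9 * K))"
    using sum_bounded_above[of "{1..N}", OF card_range_curve_purchases(2)[OF K]] by simp
  finally have "card (insert (\<lambda>_. 0) U) \<le> 1 + N * Suc (N * (9 * K))"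
    by (simp add: card_insert_if fin)
  then show "card (pieces N K t v) \<le> 1 + N * Suc (N * (9 * K))"
    using surj_card_le[OF _ sub] fin by simp
qed

theorem theorem7:
  shows "\<exists>C::real. C > 0 \<and>
    (\<forall>(N::nat) (K::nat) (v :: nat \<Rightarrow> nat \<Rightarrow> real) (t :: nat \<Rightarrow> nat set \<Rightarrow> nat).
       N \<ge> 1 \<longrightarrow> K \<ge> 1 \<longrightarrow>
       (\<forall>i\<in>{1..N}. \<forall>q\<in>{1..K}. 0 \<le> v i q) \<longrightarrow>
       (\<forall>i\<in>{1..N}. tie_breaking K (t i)) \<longrightarrow>
       finite (pieces N K t v) \<and>
       real (card (pieces N K t v)) \<le> C * (real N ^ 2 * real K * real (min N K)))"
proof (intro exI[of _ 11] conjI allI impI)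
  fix N K :: nat and v :: "nat \<Rightarrow> nat \<Rightarrow> real" and t :: "nat \<Rightarrow> nat set \<Rightarrow> nat"
  assume N: "N \<ge> 1" and K: "K \<ge> 1"
  show "finite (pieces N K t v)"
    by (rule card_pieces_le(1)[OF K])
  \<comment> \<open>The terms \<open>1\<close> and \<open>N\<close> are each absorbed by one copy of
    \<open>N * (N * K)\<close>, whence 11 = 9 + 1 + 1.\<close>
  have "N * 1 \<le> N * (N * K)" "1 * 1 \<le> N * (N * K)"
    using N K by (auto simp: Suc_le_eq)
  then have "1 + N + 9 * (N * (N * K)) \<le> 11 * (N * (N * K))"
    by linarith
  then have "1 + N * Suc (N * (9 * K)) \<le> 11 * (N\<^sup>2 * K)"
    by (simp add: power2_eq_square mult_ac)
  also have "\<dots> \<le> 11 * (N\<^sup>2 * K * min N K)"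
    using N K by simp
  finally have "card (pieces N K t v) \<le> 11 * (N\<^sup>2 * K * min N K)"
    using card_pieces_le(2)[OF K, of N t v] by linarith
  then have "real (card (pieces N K t v)) \<le> real (11 * (N\<^sup>2 * K * min N K))"
    by (rule of_nat_mono)
  then show "real (card (pieces N K t v)) \<le> 11 * (real N ^ 2 * real K * real (min N K))"
    by (simp only: of_nat_mult of_nat_power of_nat_numeral)
qed simp

end
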